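(* Let $d\ge1$, let $\|\cdot\|$ be a norm on $\mathbb{R}^d$, let $\alpha>0$, and let $(\Theta_t)_{t\in\mathbb{Z}}$ be a time series with values in $\mathbb{R}^d$ such that $0<\sum_{t\in\mathbb{Z}}\|\Theta_t\|^\alpha<\infty$ almost surely. Let $(\Theta^{RS}_t)_{t\in\mathbb{Z}}$ be a time series such that $$(\Theta^{RS}_t)_{t\in\mathbb{Z}}\overset{d}{=}\left(\frac{\Theta_{t+K(\Theta)}}{\|\Theta_{K(\Theta)}\|}\right)_{t\in\mathbb{Z}},$$ where $K(\Theta)=K((\Theta_t)_{t\in\mathbb{Z}})$ is a random integer with conditional probability mass function $$P(K(\Theta)=k\mid(\Theta_t)_{t\in\mathbb{Z}})=\frac{\|\Theta_k\|^\alpha}{\sum_{t\in\mathbb{Z}}\|\Theta_t\|^\alpha},\qquad k\in\mathbb{Z}.$$ Then $$(\Theta^{RS}_t)_{t\in\mathbb{Z}}\overset{d}{=}(\Theta_t)_{t\in\mathbb{Z}}$$ if and only if $(\Theta_t)_{t\in\mathbb{Z}}$ satisfies Property (TCF) with parameter $\alpha$.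
   Context: Property (TCF) (with parameter $\alpha>0$): an $\mathbb{R}^d$-valued time series $(\Theta_t)_{t\in\mathbb{Z}}$ satisfies Property (TCF) if $P(\|\Theta_0\|=1)=1$ and $$E\big(f(\Theta_{s-i},\dots,\Theta_{t-i})\big)=E\left(f\left(\frac{\Theta_s}{\|\Theta_i\|},\dots,\frac{\Theta_t}{\|\Theta_i\|}\right)\mathbf{1}_{\{\|\Theta_i\|>0\}}\|\Theta_i\|^\alpha\right)$$ for all integers $s\le 0\le t$, all $i\in\mathbb{Z}$ and all bounded continuous $f:(\mathbb{R}^d)^{t-s+1}\to\mathbb{R}$ such that $f(\theta_s,\dots,\theta_t)=0$ whenever $\theta_0=0$ (the expression inside the right-hand expectation is $0$ where $\|\Theta_i\|=0$). $\overset{d}{=}$ denotes equality in distribution (of random elements of $(\mathbb{R}^d)^{\mathbb{Z}}$ with its Borel $\sigma$-algebra). *)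

theory Defs
  imports "HOL-Probability.Probability"
begin

definition is_norm :: "('v::real_vector \<Rightarrow> real) \<Rightarrow> bool" where
  "is_norm N \<longleftrightarrow>
     (\<forall>x. 0 \<le> N x) \<and> (\<forall>x. N x = 0 \<longleftrightarrow> x = 0) \<and>
     (\<forall>c x. N (c *\<^sub>R x) = \<bar>c\<bar> * N x) \<and> (\<forall>x y. N (x + y) \<le> N x + N y)"

definition time_series :: "'a measure \<Rightarrow> (int \<Rightarrow> 'a \<Rightarrow> real ^ 'd) \<Rightarrow> bool" where
  "time_series M X \<longleftrightarrow> prob_space M \<and> (\<forall>t. X t \<in> borel_measurable M)"

text \<open>
  The type \<open>int \<Rightarrow> real ^ 'd\<close> carries the product topology, so \<open>borel\<close> below is the
  Borel sigma-algebra of the sequence space indexed by the integers.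
\<close>

definition eq_in_dist ::
  "'a measure \<Rightarrow> (int \<Rightarrow> 'a \<Rightarrow> real ^ 'd) \<Rightarrow> 'b measure \<Rightarrow> (int \<Rightarrow> 'b \<Rightarrow> real ^ 'd) \<Rightarrow> bool" where
  "eq_in_dist M X M' Y \<longleftrightarrow>
     distr M (borel :: (int \<Rightarrow> real ^ 'd) measure) (\<lambda>w t. X t w) =
     distr M' (borel :: (int \<Rightarrow> real ^ 'd) measure) (\<lambda>w t. Y t w)"

definition sigma_of :: "'a measure \<Rightarrow> (int \<Rightarrow> 'a \<Rightarrow> real ^ 'd) \<Rightarrow> 'a measure" where
  "sigma_of M X =
     vimage_algebra (space M) (\<lambda>w t. X t w) (borel :: (int \<Rightarrow> real ^ 'd) measure)"

text \<open>
  \<open>K\<close> is an integer-valued random variable on the probability space of \<open>X\<close>, and \<open>p k\<close> is a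
  version of the conditional probability of the event \<open>K = k\<close> given the whole series \<open>X\<close>.
\<close>

definition has_cond_pmf ::
  "'a measure \<Rightarrow> (int \<Rightarrow> 'a \<Rightarrow> real ^ 'd) \<Rightarrow> ('a \<Rightarrow> int) \<Rightarrow> (int \<Rightarrow> 'a \<Rightarrow> real) \<Rightarrow> bool" where
  "has_cond_pmf M X K p \<longleftrightarrow>
     K \<in> measurable M (count_space UNIV) \<and>
     (\<forall>k. AE w in M.
        real_cond_exp M (sigma_of M X) (indicator {w \<in> space M. K w = k}) w = p k w)"

text \<open>
  Functions of \<open>(\<theta>\<^sub>s, \<dots>, \<theta>\<^sub>t)\<close> are functions on the extensional product over the
  index set \<open>{s..t}\<close>, with the product topology. The Bochner integral is \<open>0\<close> for
  non-integrable functions, so existence of the right-hand expectation is required explicitly;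
  the left-hand integrand is bounded.
\<close>

definition TCF ::
  "(real ^ 'd \<Rightarrow> real) \<Rightarrow> real \<Rightarrow> 'a measure \<Rightarrow> (int \<Rightarrow> 'a \<Rightarrow> real ^ 'd) \<Rightarrow> bool" where
  "TCF N \<alpha> M \<Theta> \<longleftrightarrow>
     \<P>(w in M. N (\<Theta> 0 w) = 1) = 1 \<and>
     (\<forall>s t i. \<forall>f :: (int \<Rightarrow> real ^ 'd) \<Rightarrow> real.
        s \<le> 0 \<and> 0 \<le> t \<and>
        continuous_map (product_topology (\<lambda>_. euclidean) {s..t}) euclideanreal f \<and>
        bounded (f ` (PiE {s..t} (\<lambda>_. UNIV))) \<and>
        (\<forall>\<theta> \<in> PiE {s..t} (\<lambda>_. UNIV). \<theta> 0 = 0 \<longrightarrow> f \<theta> = 0) \<longrightarrow>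
        integrable M (\<lambda>w. f (\<lambda>j\<in>{s..t}. \<Theta> j w /\<^sub>R N (\<Theta> i w)) *
            indicator {w. 0 < N (\<Theta> i w)} w * N (\<Theta> i w) powr \<alpha>) \<and>
        (\<integral>w. f (\<lambda>j\<in>{s..t}. \<Theta> (j - i) w) \<partial>M) =
        (\<integral>w. f (\<lambda>j\<in>{s..t}. \<Theta> j w /\<^sub>R N (\<Theta> i w)) *
            indicator {w. 0 < N (\<Theta> i w)} w * N (\<Theta> i w) powr \<alpha> \<partial>M))"

end

theory Submission
  imports Defs
begin

text \<open>
  Let \<open>L\<close> be the law of \<open>\<Theta>\<close> and let \<open>p k = N (\<theta> k) powr \<alpha> / S\<close> with \<open>S\<close> the sum over all indices; \<open>p\<close> is invariant
  under rescaling of \<open>\<theta>\<close> and equivariant under time shifts. Conditioning on \<open>\<Theta>\<close>, the law of \<open>\<Theta>RS\<close>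
  integrates \<open>h\<close> to the sum over \<open>k\<close> of the \<open>L\<close>-integrals of \<open>p k\<close> times \<open>h\<close> at \<open>\<theta>\<close> shifted by
  \<open>k\<close> and divided by \<open>N (\<theta> k)\<close>. If the time change formula holds, applying it with \<open>i = k\<close> turns the
  \<open>k\<close>-th term into the integral of \<open>p (- k) * h\<close>, and the weights sum to \<open>1\<close>. Conversely, if
  \<open>L\<close> is the law of \<open>\<Theta>RS\<close>, both sides of the time change formula, written as sums over
  \<open>k\<close>, agree term by term after replacing \<open>k\<close> by \<open>k - i\<close>. The passage from bounded continuous
  functions of finitely many coordinates to measurable functions of the sequence goes through indicators
  of open boxes, which are increasing limits of continuous functions.
\<close>

subsection \<open>Shifts, rescalings and the random shift\<close>

definition time_shift :: "int \<Rightarrow> (int \<Rightarrow> 'v) \<Rightarrow> int \<Rightarrow> 'v" where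
  "time_shift k \<theta> = (\<lambda>t. \<theta> (t + k))"

text \<open>Where \<open>N (\<theta> k) = 0\<close>, the rescaled sequence is \<open>0\<close>; the factor \<open>N (\<theta> k) powr \<alpha>\<close> removes this case.\<close>

definition rescale :: "('v::real_vector \<Rightarrow> real) \<Rightarrow> int \<Rightarrow> (int \<Rightarrow> 'v) \<Rightarrow> int \<Rightarrow> 'v" where
  "rescale N k \<theta> = (\<lambda>t. \<theta> t /\<^sub>R N (\<theta> k))"

text \<open>
  Summing in \<open>ennreal\<close> makes measurability immediate, and a divergent sum is \<open>\<infinity>\<close> instead of
  the junk value \<open>0\<close> of \<open>infsum\<close>.
\<close>

definition total_mass :: "('v::real_vector \<Rightarrow> real) \<Rightarrow> real \<Rightarrow> (int \<Rightarrow> 'v) \<Rightarrow> ennreal" where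
  "total_mass N \<alpha> \<theta> = (\<integral>\<^sup>+k. ennreal (N (\<theta> k) powr \<alpha>) \<partial>count_space UNIV)"

definition weight :: "('v::real_vector \<Rightarrow> real) \<Rightarrow> real \<Rightarrow> int \<Rightarrow> (int \<Rightarrow> 'v) \<Rightarrow> ennreal" where
  "weight N \<alpha> k \<theta> = ennreal (N (\<theta> k) powr \<alpha>) / total_mass N \<alpha> \<theta>"

text \<open>Property (TCF) of the law, with nonnegative measurable test functions of the whole sequence.\<close>

definition time_change ::
    "('v::euclidean_space \<Rightarrow> real) \<Rightarrow> real \<Rightarrow> (int \<Rightarrow> 'v) measure \<Rightarrow> bool" where
  "time_change N \<alpha> L \<longleftrightarrow>
     (AE \<theta> in L. N (\<theta> 0) = 1) \<and>
     (\<forall>i. \<forall>h \<in> borel_measurable borel. (\<forall>\<theta>. \<theta> 0 = 0 \<longrightarrow> h \<theta> = 0) \<longrightarrow>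
        (\<integral>\<^sup>+\<theta>. h (time_shift (- i) \<theta>) \<partial>L) =
        (\<integral>\<^sup>+\<theta>. h (rescale N i \<theta>) * ennreal (N (\<theta> i) powr \<alpha>) \<partial>L))"

text \<open>
  If \<open>L\<close> is the law of \<open>\<Theta>\<close>, the left-hand side is the expectation of \<open>h\<close> under the law of \<open>\<Theta>RS\<close>.
\<close>

definition rs_invariant ::
    "('v::euclidean_space \<Rightarrow> real) \<Rightarrow> real \<Rightarrow> (int \<Rightarrow> 'v) measure \<Rightarrow> bool" where
  "rs_invariant N \<alpha> L \<longleftrightarrow>
     (\<forall>h \<in> borel_measurable borel.
        (\<integral>\<^sup>+k. \<integral>\<^sup>+\<theta>. weight N \<alpha> k \<theta> * h (time_shift k (rescale N k \<theta>)) \<partial>L \<partial>count_space UNIV) =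
        (\<integral>\<^sup>+\<theta>. h \<theta> \<partial>L))"

section \<open>Continuity of norms and measurability on the sequence space\<close>

lemma is_norm_continuous:
  fixes N :: "'v::euclidean_space \<Rightarrow> real"
  assumes "is_norm N"
  shows "continuous_on UNIV N"
proof (rule convex_on_continuous)
  have triangle: "N (x + y) \<le> N x + N y" and scale: "N (c *\<^sub>R x) = \<bar>c\<bar> * N x" for c x y
    using assms unfolding is_norm_def by blast+
  \<comment> \<open>The triangle inequality and homogeneity give convexity, and convex functions on
    a finite-dimensional space are continuous.\<close>
  show "convex_on UNIV N"
  proof (rule convex_onI)
    fix t x y assume t: "0 < (t::real)" "t < 1"
    have "N ((1 - t) *\<^sub>R x + t *\<^sub>R y) \<le> N ((1 - t) *\<^sub>R x) + N (t *\<^sub>R y)"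
      by (rule triangle)
    also have "\<dots> = (1 - t) * N x + t * N y"
      using t by (simp add: scale)
    finally show "N ((1 - t) *\<^sub>R x + t *\<^sub>R y) \<le> (1 - t) * N x + t * N y" .
  qed simp
qed simp

lemma measurable_coordinate [measurable]:
  "(\<lambda>\<theta>::int \<Rightarrow> 'v::euclidean_space. \<theta> t) \<in> borel_measurable borel"
  by (intro borel_measurable_continuous_onI continuous_on_product_coordinates)

lemma measurable_sequenceI:
  fixes f :: "'a \<Rightarrow> int \<Rightarrow> 'v::euclidean_space"
  assumes "\<And>t. (\<lambda>w. f w t) \<in> borel_measurable M"
  shows "f \<in> borel_measurable M"
  using measurable_coordinatewise_then_product[of f M] assms by blast

lemma measurable_time_shift [measurable]:
  "time_shift k \<in> borel_measurable (borel :: (int \<Rightarrow> 'v::euclidean_space) measure)"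
  unfolding time_shift_def by (rule measurable_sequenceI) simp

section \<open>Behaviour of the weights under shifts and rescalings\<close>

locale vector_norm =
  fixes N :: "'v::euclidean_space \<Rightarrow> real" and \<alpha> :: real
  assumes norm: "is_norm N" and \<alpha>_pos: "\<alpha> > 0"
begin

lemma nonneg [simp]: "0 \<le> N x"
  using norm by (simp add: is_norm_def)

lemma eq_0_iff [simp]: "N x = 0 \<longleftrightarrow> x = 0"
  using norm by (simp add: is_norm_def)

lemma zero [simp]: "N 0 = 0"
  by simp

lemma pos_iff [simp]: "0 < N x \<longleftrightarrow> x \<noteq> 0"
  by (metis nonneg eq_0_iff less_le)

lemma scale: "N (c *\<^sub>R x) = \<bar>c\<bar> * N x"
  using norm by (simp add: is_norm_def)

lemma measurable_N [measurable]: "N \<in> borel_measurable borel"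
  by (rule borel_measurable_continuous_onI[OF is_norm_continuous[OF norm]])

lemma measurable_rescale [measurable]: "rescale N k \<in> borel_measurable borel"
  unfolding rescale_def by (rule measurable_sequenceI) measurable

lemma measurable_total [measurable]: "total_mass N \<alpha> \<in> borel_measurable borel"
proof -
  interpret sigma_finite_measure "count_space (UNIV :: int set)"
    by (rule sigma_finite_measure_count_space)
  have "total_mass N \<alpha> = (\<lambda>\<theta>. \<Sum>i. ennreal (N (\<theta> (from_nat_into UNIV i)) powr \<alpha>))"
    unfolding total_mass_def
    by (subst nn_integral_bij_count_space[OF bij_betw_from_nat_into, symmetric])
       (auto simp: nn_integral_count_space_nat infinite_UNIV_int)
  then show ?thesis
    by simp
qed

lemma measurable_weight [measurable]: "weight N \<alpha> k \<in> borel_measurable borel"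
  unfolding weight_def by measurable

lemma total_shift: "total_mass N \<alpha> (time_shift k \<theta>) = total_mass N \<alpha> \<theta>"
proof -
  have "bij (\<lambda>t::int. t + k)"
    by (rule bij_plus_right)
  then show ?thesis
    unfolding total_mass_def time_shift_def by (rule nn_integral_bij_count_space)
qed

lemma weight_shift: "weight N \<alpha> j (time_shift k \<theta>) = weight N \<alpha> (j + k) \<theta>"
  unfolding weight_def total_shift by (simp add: time_shift_def)

text \<open>Numerator and total mass are multiplied by the same constant \<open>c\<close>, which is
  positive and finite and so cancels in \<open>ennreal\<close>.\<close>

lemma weight_rescale:
  assumes "\<theta> k \<noteq> 0"
  shows "weight N \<alpha> j (rescale N k \<theta>) = weight N \<alpha> j \<theta>"
proof -
  define c where "c = ennreal (inverse (N (\<theta> k)) powr \<alpha>)"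
  have c: "c \<noteq> 0" "c \<noteq> \<infinity>"
    using assms by (auto simp: c_def)
  have summand: "ennreal (N (rescale N k \<theta> t) powr \<alpha>) = ennreal (N (\<theta> t) powr \<alpha>) * c" for t
    by (simp add: c_def rescale_def scale powr_mult ennreal_mult' mult.commute)
  have "total_mass N \<alpha> (rescale N k \<theta>) = total_mass N \<alpha> \<theta> * c"
    unfolding total_mass_def summand by (rule nn_integral_multc) simp
  then show ?thesis
    unfolding weight_def summand using divide_mult_eq[OF c] by simp
qed

lemma sum_weight:
  assumes "0 < total_mass N \<alpha> \<theta>" "total_mass N \<alpha> \<theta> < \<infinity>"
  shows "(\<integral>\<^sup>+k. weight N \<alpha> k \<theta> \<partial>count_space UNIV) = 1"
proof -
  have "(\<integral>\<^sup>+k. weight N \<alpha> k \<theta> \<partial>count_space UNIV) = total_mass N \<alpha> \<theta> / total_mass N \<alpha> \<theta>"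
    unfolding weight_def by (subst nn_integral_divide) (simp_all add: total_mass_def)
  then show ?thesis
    using assms by simp
qed

end

section \<open>Random shift invariance and time change for a law on the sequence space\<close>

locale series_law = vector_norm N \<alpha> + prob_space L
  for N :: "'v::euclidean_space \<Rightarrow> real" and \<alpha> and L :: "(int \<Rightarrow> 'v) measure" +
  assumes sets_L [measurable_cong]: "sets L = sets borel"
    and total_AE: "AE \<theta> in L. 0 < total_mass N \<alpha> \<theta> \<and> total_mass N \<alpha> \<theta> < \<infinity>"
begin

lemma time_change_imp_rs_invariant:
  assumes "time_change N \<alpha> L"
  shows "rs_invariant N \<alpha> L"
  unfolding rs_invariant_def
proof
  fix h :: "(int \<Rightarrow> 'v) \<Rightarrow> ennreal" assume [measurable]: "h \<in> borel_measurable borel"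
  have one: "AE \<theta> in L. N (\<theta> 0) = 1"
    and tc: "\<And>i g. g \<in> borel_measurable borel \<Longrightarrow> (\<And>\<theta>. \<theta> 0 = 0 \<Longrightarrow> g \<theta> = 0) \<Longrightarrow>
        (\<integral>\<^sup>+\<theta>. g (time_shift (- i) \<theta>) \<partial>L) =
        (\<integral>\<^sup>+\<theta>. g (rescale N i \<theta>) * ennreal (N (\<theta> i) powr \<alpha>) \<partial>L)"
    using assms by (auto simp: time_change_def)
  have "(\<integral>\<^sup>+\<theta>. weight N \<alpha> k \<theta> * h (time_shift k (rescale N k \<theta>)) \<partial>L) =
      (\<integral>\<^sup>+\<theta>. weight N \<alpha> (- k) \<theta> * h \<theta> \<partial>L)" for k
  proof -
    \<comment> \<open>Under \<open>N (\<theta> 0) = 1\<close> the weight of index \<open>0\<close> in the rescaled sequence supplies the missing \<open>1 / total_mass\<close>.\<close>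
    define g where "g \<theta> = weight N \<alpha> 0 \<theta> * h (time_shift k \<theta>)" for \<theta>
    have [measurable]: "g \<in> borel_measurable borel"
      unfolding g_def by measurable
    have "(\<integral>\<^sup>+\<theta>. weight N \<alpha> k \<theta> * h (time_shift k (rescale N k \<theta>)) \<partial>L) =
        (\<integral>\<^sup>+\<theta>. g (rescale N k \<theta>) * ennreal (N (\<theta> k) powr \<alpha>) \<partial>L)"
    proof (rule nn_integral_cong_AE, use one in eventually_elim)
      case (elim \<theta>)
      show ?case
      proof (cases "\<theta> k = 0")
        \<comment> \<open>Both integrands carry the factor
          \<open>N (\<theta> k) powr \<alpha>\<close>, which is 0 here.\<close>
        case True
        then show ?thesis using \<alpha>_pos by (simp add: weight_def)
      next
        case False
        then show ?thesis
          using elim by (simp add: g_def weight_rescale) (simp add: weight_def divide_ennreal_def mult_ac)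
      qed
    qed
    also have "\<dots> = (\<integral>\<^sup>+\<theta>. g (time_shift (- k) \<theta>) \<partial>L)"
      \<comment> \<open>\<open>g\<close> is an admissible test function because its factor
        \<open>weight N \<alpha> 0\<close> vanishes where \<open>\<theta> 0 = 0\<close>.\<close>
      using \<alpha>_pos by (intro tc[symmetric]) (auto simp: g_def weight_def)
    also have "\<dots> = (\<integral>\<^sup>+\<theta>. weight N \<alpha> (- k) \<theta> * h \<theta> \<partial>L)"
      unfolding g_def weight_shift by (simp add: time_shift_def)
    finally show ?thesis .
  qed
  then have "(\<integral>\<^sup>+k. \<integral>\<^sup>+\<theta>. weight N \<alpha> k \<theta> * h (time_shift k (rescale N k \<theta>)) \<partial>L \<partial>count_space UNIV) =
      (\<integral>\<^sup>+k. \<integral>\<^sup>+\<theta>. weight N \<alpha> (- k) \<theta> * h \<theta> \<partial>L \<partial>count_space UNIV)"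
    by simp
  also have "\<dots> = (\<integral>\<^sup>+k. \<integral>\<^sup>+\<theta>. weight N \<alpha> k \<theta> * h \<theta> \<partial>L \<partial>count_space UNIV)"
    by (rule nn_integral_bij_count_space[OF bij_uminus])
  \<comment> \<open>The argument of \<open>h\<close> no longer depends on \<open>k\<close>, so after
    the interchange the weights add up to 1 almost everywhere.\<close>
  also have "\<dots> = (\<integral>\<^sup>+\<theta>. \<integral>\<^sup>+k. weight N \<alpha> k \<theta> * h \<theta> \<partial>count_space UNIV \<partial>L)"
    by (rule nn_integral_count_space_nn_integral[symmetric]) auto
  also have "\<dots> = (\<integral>\<^sup>+\<theta>. h \<theta> \<partial>L)"
    using total_AE
    by (intro nn_integral_cong_AE, eventually_elim) (simp add: nn_integral_multc sum_weight)
  finally show "(\<integral>\<^sup>+k. \<integral>\<^sup>+\<theta>. weight N \<alpha> k \<theta> * h (time_shift k (rescale N k \<theta>)) \<partial>L \<partial>count_space UNIV) =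
      (\<integral>\<^sup>+\<theta>. h \<theta> \<partial>L)" .
qed

text \<open>Invariance is used three times: for the indicator of
  \<open>N (\<theta> 0) \<noteq> 1\<close>, for \<open>h\<close> after the shift by
  \<open>- i\<close>, and for \<open>H\<close>. The last two expansions differ only by moving the
  summation index by \<open>i\<close>.\<close>

lemma rs_invariant_imp_time_change:
  assumes "rs_invariant N \<alpha> L"
  shows "time_change N \<alpha> L"
proof -
  have inv: "(\<integral>\<^sup>+k. \<integral>\<^sup>+\<theta>. weight N \<alpha> k \<theta> * h (time_shift k (rescale N k \<theta>)) \<partial>L \<partial>count_space UNIV) =
      (\<integral>\<^sup>+\<theta>. h \<theta> \<partial>L)" if "h \<in> borel_measurable borel" for h
    using assms that by (auto simp: rs_invariant_def)
  have "AE \<theta> in L. N (\<theta> 0) = 1"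
  proof -
    define h :: "(int \<Rightarrow> 'v) \<Rightarrow> ennreal" where "h \<theta> = indicator {x. x \<noteq> 1} (N (\<theta> 0))" for \<theta>
    have [measurable]: "h \<in> borel_measurable borel"
      unfolding h_def by measurable
    \<comment> \<open>Either the weight vanishes or the rescaled and shifted sequence has norm 1 at
      index 0.\<close>
    have 0: "weight N \<alpha> k \<theta> * h (time_shift k (rescale N k \<theta>)) = 0" for k \<theta>
      using \<alpha>_pos by (cases "\<theta> k = 0") (auto simp: h_def time_shift_def rescale_def scale weight_def)
    have "(\<integral>\<^sup>+\<theta>. h \<theta> \<partial>L) = 0"
      using inv[of h] unfolding 0 by simp
    then have "AE \<theta> in L. h \<theta> = 0"
      by (simp add: nn_integral_0_iff_AE)
    then show ?thesis
      by eventually_elim (auto simp: h_def indicator_def split: if_splits)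
  qed
  moreover have "(\<integral>\<^sup>+\<theta>. h (time_shift (- i) \<theta>) \<partial>L) =
      (\<integral>\<^sup>+\<theta>. h (rescale N i \<theta>) * ennreal (N (\<theta> i) powr \<alpha>) \<partial>L)"
    if [measurable]: "h \<in> borel_measurable borel" and h0: "\<And>\<theta>. \<theta> 0 = 0 \<Longrightarrow> h \<theta> = 0" for i h
  proof -
    define H where "H \<theta> = h (rescale N i \<theta>) * ennreal (N (\<theta> i) powr \<alpha>)" for \<theta>
    have [measurable]: "H \<in> borel_measurable borel"
      unfolding H_def by measurable
    have *: "weight N \<alpha> (k - i) \<theta> * H (time_shift (k - i) (rescale N (k - i) \<theta>)) =
        weight N \<alpha> k \<theta> * h (time_shift (- i) (time_shift k (rescale N k \<theta>)))" for k \<theta>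
    proof (cases "\<theta> (k - i) = 0")
      \<comment> \<open>On the left the weight is 0; on the right the argument of \<open>h\<close>
        is 0 at index 0, so \<open>h0\<close> applies.\<close>
      case True
      then show ?thesis
        using \<alpha>_pos by (simp add: weight_def h0 time_shift_def rescale_def)
    next
      case False
      \<comment> \<open>\<open>T\<close> is normalized at \<open>k - i\<close>. Normalizing it again
        at \<open>i\<close> cancels \<open>N (\<theta> (k - i))\<close>; where
        \<open>\<theta> k = 0\<close>, both sequences compared are 0 by
        \<open>inverse 0 = 0\<close>.\<close>
      define T where "T = time_shift (k - i) (rescale N (k - i) \<theta>)"
      have Ti: "N (T i) = N (\<theta> k) / N (\<theta> (k - i))"
        by (simp add: T_def time_shift_def rescale_def scale divide_inverse)
      have "rescale N i T = time_shift (- i) (time_shift k (rescale N k \<theta>))"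
        using False unfolding rescale_def[of N i] Ti
        by (auto simp: T_def time_shift_def rescale_def field_simps)
      moreover have weight_T: "weight N \<alpha> k \<theta> = weight N \<alpha> (k - i) \<theta> * ennreal (N (T i) powr \<alpha>)"
      proof -
        have "N (\<theta> (k - i)) powr \<alpha> * N (T i) powr \<alpha> = N (\<theta> k) powr \<alpha>"
          using False by (simp add: Ti powr_divide)
        then have eq: "ennreal (N (\<theta> k) powr \<alpha>) =
            ennreal (N (\<theta> (k - i)) powr \<alpha>) * ennreal (N (T i) powr \<alpha>)"
          by (simp flip: ennreal_mult')
        show ?thesis
          unfolding weight_def eq divide_ennreal_def by (simp only: mult_ac)
      qed
      ultimately show ?thesis
        unfolding H_def T_def[symmetric] weight_T by (simp only: mult_ac)
    qed
    have "(\<integral>\<^sup>+\<theta>. h (time_shift (- i) \<theta>) \<partial>L) = (\<integral>\<^sup>+k. \<integral>\<^sup>+\<theta>. weight N \<alpha> (k - i) \<theta> *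
        H (time_shift (k - i) (rescale N (k - i) \<theta>)) \<partial>L \<partial>count_space UNIV)"
      unfolding * by (rule inv[symmetric]) measurable
    also have "\<dots> = (\<integral>\<^sup>+k. \<integral>\<^sup>+\<theta>. weight N \<alpha> k \<theta> * H (time_shift k (rescale N k \<theta>)) \<partial>L \<partial>count_space UNIV)"
      using bij_plus_right[of "- i"]
      by (subst nn_integral_bij_count_space[symmetric, of "\<lambda>k. k - i" UNIV]) auto
    also have "\<dots> = (\<integral>\<^sup>+\<theta>. H \<theta> \<partial>L)"
      by (rule inv) measurable
    finally show ?thesis
      unfolding H_def .
  qed
  ultimately show ?thesis
    unfolding time_change_def by blast
qed

lemma rs_invariant_iff_time_change: "rs_invariant N \<alpha> L \<longleftrightarrow> time_change N \<alpha> L"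
  using rs_invariant_imp_time_change time_change_imp_rs_invariant by blast

end

subsection \<open>Open boxes\<close>

text \<open>The boxes are closed under intersection and include \<open>UNIV\<close> and a countable
  basis. They therefore form a generating pi-system, on which finite measures are
  determined.\<close>

lemma measure_eqI_open_boxes:
  fixes P Q :: "('i::countable \<Rightarrow> 'v::second_countable_topology) measure"
  assumes sets: "sets P = sets borel" "sets Q = sets borel" and "finite_measure P"
    and eq: "\<And>V. (\<And>j. open (V j)) \<Longrightarrow> finite {j. V j \<noteq> UNIV} \<Longrightarrow>
      emeasure P (PiE UNIV V) = emeasure Q (PiE UNIV V)"
  shows "P = Q"
proof -
  interpret P: finite_measure P by fact
  define E :: "('i \<Rightarrow> 'v) set set"
    where "E = {PiE UNIV V | V. (\<forall>j. open (V j)) \<and> finite {j. V j \<noteq> UNIV}}"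
  obtain B :: "('i \<Rightarrow> 'v) set set" where B: "topological_basis B" "countable B"
    "\<And>k. k \<in> B \<Longrightarrow> \<exists>X. k = PiE UNIV X \<and> (\<forall>i. open (X i)) \<and> finite {i. X i \<noteq> UNIV}"
    using product_topology_countable_basis by metis
  have "sets borel = sigma_sets UNIV E"
  proof (rule antisym)
    have "B \<subseteq> E"
      using B(3) unfolding E_def by blast
    then show "sets borel \<subseteq> sigma_sets UNIV E"
      by (simp add: borel_eq_countable_basis[OF B(2,1)] sigma_sets_mono')
    have "E \<subseteq> sets borel"
      by (auto simp: E_def intro!: borel_open open_PiE)
    then show "sigma_sets UNIV E \<subseteq> sets borel"
      using sets.sigma_sets_subset[of E borel] by simp
  qed
  moreover have "Int_stable E"
  proof (rule Int_stableI)
    fix a b assume "a \<in> E" "b \<in> E"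
    then obtain V W where V: "a = PiE UNIV V" "\<And>j. open (V j)" "finite {j. V j \<noteq> UNIV}"
      and W: "b = PiE UNIV W" "\<And>j. open (W j)" "finite {j. W j \<noteq> UNIV}"
      unfolding E_def by blast
    have "finite {j. V j \<inter> W j \<noteq> UNIV}"
      by (rule finite_subset[OF _ finite_UnI[OF V(3) W(3)]]) auto
    moreover have "a \<inter> b = PiE UNIV (\<lambda>j. V j \<inter> W j)"
      by (simp add: V W PiE_Int)
    ultimately show "a \<inter> b \<in> E"
      unfolding E_def using V(2) W(2)
      by (intro CollectI exI[of _ "\<lambda>j. V j \<inter> W j"]) (simp add: open_Int)
  qed
  moreover have "UNIV \<in> E"
    unfolding E_def by (auto intro!: exI[of _ "\<lambda>_. UNIV"])
  ultimately show ?thesis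
    using eq by (intro measure_eqI_generator_eq[of E UNIV P Q "\<lambda>_. UNIV"]) (auto simp: sets E_def)
qed

text \<open>Truncated multiples of the distance to the complement. The case \<open>U = UNIV\<close>
  is separate because \<open>infdist x {} = 0\<close> would give 0 instead of 1.\<close>

definition bump :: "'v::metric_space set \<Rightarrow> nat \<Rightarrow> 'v \<Rightarrow> real" where
  "bump U n x = (if U = UNIV then 1 else min 1 (real n * infdist x (- U)))"

lemma bump_nonneg: "0 \<le> bump U n x" and bump_le_1: "bump U n x \<le> 1"
  by (auto simp: bump_def infdist_nonneg)

lemma bump_mono: "m \<le> n \<Longrightarrow> bump U m x \<le> bump U n x"
proof -
  assume "m \<le> n"
  then have "real m * infdist x (- U) \<le> real n * infdist x (- U)"
    by (intro mult_right_mono) (auto simp: infdist_nonneg)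
  then show ?thesis
    by (auto simp: bump_def)
qed

lemma bump_outside: "x \<notin> U \<Longrightarrow> bump U n x = 0"
  by (auto simp: bump_def)

lemma continuous_on_bump: "continuous_on S (bump U n)"
  unfolding bump_def by (cases "U = UNIV") (auto intro!: continuous_intros)

text \<open>Inside an open set the distance to the complement is positive, so the minimum equals 1
  from some \<open>n\<close> on.\<close>

lemma bump_tendsto_indicator:
  assumes "open U"
  shows "(\<lambda>n. bump U n x) \<longlonglongrightarrow> indicator U x"
proof (cases "x \<in> U \<and> U \<noteq> UNIV")
  case True
  then have "0 < infdist x (- U)"
    using assms by (intro infdist_pos_not_in_closed) auto
  then obtain m where m: "1 < real m * infdist x (- U)"
    using reals_Archimedean3 by blast
  have "bump U n x = 1" if "m \<le> n" for n
    using True m bump_mono[OF that, of U x] bump_le_1[of U n x] by (simp add: bump_def)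
  then have "\<forall>\<^sub>F n in sequentially. bump U n x = 1"
    unfolding eventually_sequentially by blast
  then show ?thesis
    using True by (simp add: tendsto_eventually)
next
  case False
  then show ?thesis
    by (cases "U = UNIV") (auto simp: bump_outside, simp add: bump_def)
qed

definition box_bump :: "int set \<Rightarrow> (int \<Rightarrow> 'v::metric_space set) \<Rightarrow> nat \<Rightarrow> (int \<Rightarrow> 'v) \<Rightarrow> real" where
  "box_bump J V n \<theta> = (\<Prod>j\<in>J. bump (V j) n (\<theta> j))"

lemma box_bump_nonneg: "0 \<le> box_bump J V n \<theta>"
  unfolding box_bump_def by (intro prod_nonneg) (auto simp: bump_nonneg)

lemma box_bump_le_1: "box_bump J V n \<theta> \<le> 1"
  unfolding box_bump_def by (intro prod_le_1) (auto simp: bump_nonneg bump_le_1)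

lemma box_bump_mono: "m \<le> n \<Longrightarrow> box_bump J V m \<theta> \<le> box_bump J V n \<theta>"
  unfolding box_bump_def by (intro prod_mono) (auto simp: bump_nonneg bump_mono)

text \<open>\<open>TCF\<close> feeds restricted sequences to its test functions; this removes the
  restriction.\<close>

lemma box_bump_restrict: "box_bump J V n (restrict \<theta> J) = box_bump J V n \<theta>"
  unfolding box_bump_def by (intro prod.cong) auto

lemma continuous_map_box_bump:
  assumes "finite J"
  shows "continuous_map (product_topology (\<lambda>_. euclidean) J) euclideanreal (box_bump J V n)"
  unfolding box_bump_def
proof (intro continuous_map_prod assms)
  fix j assume "j \<in> J"
  then have "continuous_map (product_topology (\<lambda>_. euclidean) J) euclidean (\<lambda>\<theta>. \<theta> j)"
    by (rule continuous_map_product_projection)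
  then show "continuous_map (product_topology (\<lambda>_. euclidean) J) euclideanreal
      (\<lambda>\<theta>. bump (V j) n (\<theta> j))"
    using continuous_map_compose[of _ euclidean "\<lambda>\<theta>. \<theta> j" euclideanreal "bump (V j) n"]
    by (simp add: o_def continuous_on_bump)
qed

text \<open>All sides outside \<open>J\<close> are \<open>UNIV\<close>, so a finite product over
  \<open>J\<close> detects membership in the whole box.\<close>

lemma box_bump_tendsto_indicator:
  assumes "finite J" "\<And>j. open (V j)" "{j. V j \<noteq> UNIV} \<subseteq> J"
  shows "(\<lambda>n. box_bump J V n \<theta>) \<longlonglongrightarrow> indicator (PiE UNIV V) \<theta>"
proof -
  have "(\<lambda>n. box_bump J V n \<theta>) \<longlonglongrightarrow> (\<Prod>j\<in>J. indicator (V j) (\<theta> j))"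
    unfolding box_bump_def using assms by (intro tendsto_prod bump_tendsto_indicator)
  also have "(\<Prod>j\<in>J. indicator (V j) (\<theta> j)) = (indicator (PiE UNIV V) \<theta> :: real)"
  proof (cases "\<theta> \<in> PiE UNIV V")
    case True
    then show ?thesis by (auto simp: PiE_iff)
  next
    case False
    then obtain j where j: "\<theta> j \<notin> V j" by auto
    then have "j \<in> J" using assms(3) by auto
    then show ?thesis using j False assms(1) by (auto simp: indicator_def)
  qed
  finally show ?thesis .
qed

lemma measurable_box_bump [measurable]:
  "box_bump J V n \<in> borel_measurable (borel :: (int \<Rightarrow> 'v::euclidean_space) measure)"
proof -
  have [measurable]: "bump U n \<in> borel_measurable (borel :: 'v measure)" for U
    by (intro borel_measurable_continuous_onI continuous_on_bump)
  show ?thesis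
    unfolding box_bump_def by measurable
qed

text \<open>Restriction is continuous coordinate by coordinate, so a test function of
  \<open>TCF\<close> becomes a Borel function of the whole sequence.\<close>

lemma borel_measurable_restrict:
  fixes f :: "(int \<Rightarrow> 'v::euclidean_space) \<Rightarrow> real"
  assumes "continuous_map (product_topology (\<lambda>_. euclidean) J) euclideanreal f"
  shows "(\<lambda>\<theta>. f (restrict \<theta> J)) \<in> borel_measurable borel"
proof -
  have "continuous_map euclidean (product_topology (\<lambda>_. euclidean) J) (\<lambda>\<theta>::int \<Rightarrow> 'v. restrict \<theta> J)"
    unfolding continuous_map_componentwise
    by (auto simp: continuous_on_product_coordinates)
  from continuous_map_compose[OF this assms] show ?thesis
    by (intro borel_measurable_continuous_onI) (simp add: o_def)
qed

section \<open>From open boxes to measurable test functions\<close>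

context series_law
begin

text \<open>The two sides are integrals of \<open>h\<close> against measures \<open>P\<close> and
  \<open>Q\<close> carried by \<open>Z\<close>; nothing is lost there since \<open>h\<close>
  vanishes off \<open>Z\<close>. Boxes avoiding 0 at index 0 suffice to show
  \<open>P = Q\<close>.\<close>

lemma time_changeI_boxes:
  assumes one: "AE \<theta> in L. N (\<theta> 0) = 1"
    and box: "\<And>V i. (\<And>j. open (V j)) \<Longrightarrow> finite {j. V j \<noteq> UNIV} \<Longrightarrow> 0 \<notin> V 0 \<Longrightarrow>
        (\<integral>\<^sup>+\<theta>. indicator (PiE UNIV V) (time_shift (- i) \<theta>) \<partial>L) =
        (\<integral>\<^sup>+\<theta>. indicator (PiE UNIV V) (rescale N i \<theta>) * ennreal (N (\<theta> i) powr \<alpha>) \<partial>L)"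
  shows "time_change N \<alpha> L"
  unfolding time_change_def
proof (intro conjI one allI ballI impI)
  fix i and h :: "(int \<Rightarrow> 'v) \<Rightarrow> ennreal"
  assume [measurable]: "h \<in> borel_measurable borel" and h0: "\<forall>\<theta>. \<theta> 0 = 0 \<longrightarrow> h \<theta> = 0"
  define Z :: "(int \<Rightarrow> 'v) set" where "Z = {\<theta>. \<theta> 0 \<noteq> 0}"
  have [measurable]: "Z \<in> sets borel"
    unfolding Z_def by measurable
  define P where "P = density (distr L borel (time_shift (- i))) (indicator Z)"
  define Q where
    "Q = density (distr (density L (\<lambda>\<theta>. ennreal (N (\<theta> i) powr \<alpha>))) borel (rescale N i)) (indicator Z)"
  have sets_PQ [measurable_cong]: "sets P = sets borel" "sets Q = sets borel"
    by (simp_all add: P_def Q_def)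
  have space_PQ: "space P = UNIV" "space Q = UNIV"
    using sets_PQ[THEN sets_eq_imp_space_eq] by simp_all
  have nn_P: "(\<integral>\<^sup>+\<theta>. g \<theta> \<partial>P) = (\<integral>\<^sup>+\<theta>. indicator Z (time_shift (- i) \<theta>) * g (time_shift (- i) \<theta>) \<partial>L)"
    if [measurable]: "g \<in> borel_measurable borel" for g
    unfolding P_def by (simp add: nn_integral_density nn_integral_distr)
  have nn_Q: "(\<integral>\<^sup>+\<theta>. g \<theta> \<partial>Q) = (\<integral>\<^sup>+\<theta>. ennreal (N (\<theta> i) powr \<alpha>) *
      (indicator Z (rescale N i \<theta>) * g (rescale N i \<theta>)) \<partial>L)"
    if [measurable]: "g \<in> borel_measurable borel" for g
    unfolding Q_def by (simp add: nn_integral_density nn_integral_distr)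
  have "P = Q"
  proof (rule measure_eqI_open_boxes)
    have "emeasure P UNIV = (\<integral>\<^sup>+\<theta>. indicator Z (time_shift (- i) \<theta>) \<partial>L)"
      using nn_P[of "indicator UNIV"] by (simp add: sets_PQ space_PQ)
    also have "\<dots> \<le> (\<integral>\<^sup>+\<theta>. 1 \<partial>L)"
      by (intro nn_integral_mono) (simp add: indicator_def)
    finally show "finite_measure P"
      by (intro finite_measureI) (auto simp: space_PQ emeasure_space_1 top_unique)
  next
    fix V :: "int \<Rightarrow> 'v set" assume V: "\<And>j. open (V j)" "finite {j. V j \<noteq> UNIV}"
    \<comment> \<open>Removing \<open>0\<close> from the \<open>0\<close>-th side keeps the box open and makes it avoid \<open>\<theta> 0 = 0\<close>.\<close>
    define W where "W = V(0 := V 0 - {0})"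
    have W: "\<And>j. open (W j)" "0 \<notin> W 0"
      using V(1) by (auto simp: W_def open_delete)
    have "finite {j. W j \<noteq> UNIV}"
      by (rule finite_subset[of _ "insert 0 {j. V j \<noteq> UNIV}"]) (use V(2) in \<open>auto simp: W_def\<close>)
    note box_W = box[OF W(1) this W(2), of i]
    have ind: "indicator Z \<theta> * indicator (PiE UNIV V) \<theta> = (indicator (PiE UNIV W) \<theta> :: ennreal)" for \<theta>
      by (auto simp: Z_def W_def indicator_def PiE_iff split: if_splits)
    have [measurable]: "PiE UNIV V \<in> sets borel"
      using V by (intro borel_open open_PiE)
    have "emeasure P (PiE UNIV V) = (\<integral>\<^sup>+\<theta>. indicator (PiE UNIV W) (time_shift (- i) \<theta>) \<partial>L)"
      using nn_P[of "indicator (PiE UNIV V)"] unfolding ind by (simp add: sets_PQ)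
    also have "\<dots> = emeasure Q (PiE UNIV V)"
      using nn_Q[of "indicator (PiE UNIV V)"] unfolding ind box_W by (simp add: sets_PQ mult.commute)
    finally show "emeasure P (PiE UNIV V) = emeasure Q (PiE UNIV V)" .
  qed (simp_all add: sets_PQ)
  moreover have Zh: "indicator Z \<theta> * h \<theta> = h \<theta>" for \<theta>
    using h0 by (simp add: Z_def indicator_def)
  ultimately show "(\<integral>\<^sup>+\<theta>. h (time_shift (- i) \<theta>) \<partial>L) =
      (\<integral>\<^sup>+\<theta>. h (rescale N i \<theta>) * ennreal (N (\<theta> i) powr \<alpha>) \<partial>L)"
    using nn_P[of h] nn_Q[of h] unfolding Zh by (simp add: mult.commute)
qed

end

subsection \<open>Time series\<close>

locale series = vector_norm N \<alpha> + M: prob_space M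
  for N :: "real ^ 'd \<Rightarrow> real" and \<alpha> and M :: "'a measure" +
  fixes \<Theta> :: "int \<Rightarrow> 'a \<Rightarrow> real ^ 'd"
  assumes measurable_\<Theta> [measurable]: "\<And>t. \<Theta> t \<in> borel_measurable M"
    and sum_AE: "AE w in M. (\<lambda>t. N (\<Theta> t w) powr \<alpha>) summable_on UNIV \<and>
           0 < (\<Sum>\<^sub>\<infinity>t. N (\<Theta> t w) powr \<alpha>)"
begin

abbreviation trajectory :: "'a \<Rightarrow> int \<Rightarrow> real ^ 'd" where
  "trajectory w \<equiv> \<lambda>t. \<Theta> t w"

lemma measurable_trajectory [measurable]: "trajectory \<in> borel_measurable M"
  by (rule measurable_sequenceI) simp

abbreviation law :: "(int \<Rightarrow> real ^ 'd) measure" where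
  "law \<equiv> distr M borel trajectory"

text \<open>For a summable family \<open>infsum\<close> is the true sum. The link to the
  \<open>ennreal\<close> sum is \<open>infsetsum\<close>, an integral over the counting
  measure.\<close>

lemma total_mass_trajectory:
  "AE w in M. total_mass N \<alpha> (trajectory w) = ennreal (\<Sum>\<^sub>\<infinity>t. N (\<Theta> t w) powr \<alpha>) \<and>
      0 < (\<Sum>\<^sub>\<infinity>t. N (\<Theta> t w) powr \<alpha>)"
  using sum_AE
proof eventually_elim
  case (elim w)
  then have "Infinite_Set_Sum.abs_summable_on (\<lambda>t. N (\<Theta> t w) powr \<alpha>) UNIV"
    by (simp flip: abs_summable_equivalent)
  then show ?case
    using elim by (simp add: total_mass_def nn_integral_conv_infsetsum infsetsum_infsum)
qed

sublocale series_law N \<alpha> law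
proof -
  interpret law: prob_space law
    by (rule M.prob_space_distr) measurable
  show "series_law N \<alpha> law"
  proof
    have "AE w in M. 0 < total_mass N \<alpha> (trajectory w) \<and> total_mass N \<alpha> (trajectory w) < \<infinity>"
      using total_mass_trajectory by eventually_elim simp
    then show "AE \<theta> in law. 0 < total_mass N \<alpha> \<theta> \<and> total_mass N \<alpha> \<theta> < \<infinity>"
      by (subst AE_distr_iff) simp_all
  qed simp
qed

section \<open>Property (TCF) and the measurable time change formula\<close>

lemma TCF_imp_time_change:
  assumes "TCF N \<alpha> M \<Theta>"
  shows "time_change N \<alpha> law"
proof (rule time_changeI_boxes)
  show "AE \<theta> in law. N (\<theta> 0) = 1"
    using assms unfolding TCF_def by (subst AE_distr_iff) (auto simp: M.prob_Collect_eq_1)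
next
  fix V :: "int \<Rightarrow> (real ^ 'd) set" and i
  assume V: "\<And>j. open (V j)" "finite {j. V j \<noteq> UNIV}" "0 \<notin> V 0"
  \<comment> \<open>Inserting 0 makes the finite set nonempty and forces \<open>s \<le> 0\<close>
    and \<open>0 \<le> t\<close>.\<close>
  define s where "s = Min (insert 0 {j. V j \<noteq> UNIV})"
  define t where "t = Max (insert 0 {j. V j \<noteq> UNIV})"
  have "insert 0 {j. V j \<noteq> UNIV} \<subseteq> {s..t}"
    unfolding s_def t_def using V(2) by (intro subsetI) (simp only: atLeastAtMost_iff Min_le Max_ge finite_insert)
  then have st: "s \<le> 0" "0 \<le> t" "{j. V j \<noteq> UNIV} \<subseteq> {s..t}"
    by simp_all
  \<comment> \<open>These functions are admissible in \<open>TCF\<close> and increase to the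
    indicator of the box, so monotone convergence carries the formula to the box.\<close>
  define f where "f = box_bump {s..t} V"
  have [measurable]: "f n \<in> borel_measurable borel" for n
    unfolding f_def by simp
  have [measurable]: "PiE UNIV V \<in> sets borel"
    using V by (intro borel_open open_PiE)
  have f_nonneg: "0 \<le> f n \<theta>" and f_le_1: "f n \<theta> \<le> 1" for n \<theta>
    by (auto simp: f_def box_bump_nonneg box_bump_le_1)
  \<comment> \<open>The factor \<open>c\<close> is 1 on the left and
    \<open>N (\<theta> i) powr \<alpha>\<close> on the right; this explains the \<open>* 1\<close>
    in \<open>step\<close>.\<close>
  have incseq: "incseq (\<lambda>n w. ennreal (f n (g w)) * c w)" for g and c :: "(int \<Rightarrow> real ^ 'd) \<Rightarrow> ennreal"
    unfolding incseq_def le_fun_def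
    by (auto simp: f_def box_bump_mono intro!: mult_right_mono ennreal_leI)
  have lim: "(\<lambda>n. ennreal (f n \<theta>)) \<longlonglongrightarrow> indicator (PiE UNIV V) \<theta>" for \<theta>
    using tendsto_ennrealI[OF box_bump_tendsto_indicator[OF _ V(1) st(3)], of \<theta>]
    by (simp add: f_def ennreal_indicator)
  have lim_mult: "(\<lambda>n. ennreal (f n \<theta>) * ennreal r) \<longlonglongrightarrow> indicator (PiE UNIV V) \<theta> * ennreal r" for \<theta> r
    using ennreal_tendsto_cmult[OF _ lim, of "ennreal r" \<theta>] by (simp add: mult.commute)
  have step: "(\<integral>\<^sup>+\<theta>. ennreal (f n (time_shift (- i) \<theta>)) * 1 \<partial>law) =
      (\<integral>\<^sup>+\<theta>. ennreal (f n (rescale N i \<theta>)) * ennreal (N (\<theta> i) powr \<alpha>) \<partial>law)" for n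
  proof -
    have restrict: "f n (\<lambda>j\<in>{s..t}. \<theta> j) = f n \<theta>" for \<theta>
      by (simp add: f_def box_bump_restrict)
    have "continuous_map (product_topology (\<lambda>_. euclidean) {s..t}) euclideanreal (f n)"
      unfolding f_def by (rule continuous_map_box_bump) simp
    moreover have "bounded (f n ` PiE {s..t} (\<lambda>_. UNIV))"
      unfolding bounded_iff using f_nonneg f_le_1 by (intro exI[of _ 1]) auto
    moreover have "\<theta> 0 = 0 \<Longrightarrow> f n \<theta> = 0" for \<theta>
      using st V(3) by (auto simp: f_def box_bump_def bump_outside intro!: bexI[of _ 0])
    ultimately have "s \<le> 0 \<and> 0 \<le> t \<and>
        continuous_map (product_topology (\<lambda>_. euclidean) {s..t}) euclideanreal (f n) \<and>
        bounded (f n ` PiE {s..t} (\<lambda>_. UNIV)) \<and>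
        (\<forall>\<theta>\<in>PiE {s..t} (\<lambda>_. UNIV). \<theta> 0 = 0 \<longrightarrow> f n \<theta> = 0)"
      using st(1,2) by simp
    note tcf = assms[unfolded TCF_def, THEN conjunct2, THEN spec, THEN spec, THEN spec, THEN spec,
        THEN mp, OF this, of i, unfolded restrict]
    note int = tcf[THEN conjunct1] and eq = tcf[THEN conjunct2]
    have ind: "f n (\<lambda>j. \<Theta> j w /\<^sub>R N (\<Theta> i w)) * indicator {w. 0 < N (\<Theta> i w)} w * N (\<Theta> i w) powr \<alpha> =
        f n (rescale N i (trajectory w)) * N (\<Theta> i w) powr \<alpha>" for w
      by (cases "\<Theta> i w = 0") (simp_all add: rescale_def)
    have shift: "f n (\<lambda>j. \<Theta> (j - i) w) = f n (time_shift (- i) (trajectory w))" for w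
      by (simp add: time_shift_def)
    \<comment> \<open>Passing between Bochner and nonnegative integrals needs integrability: here it
      follows from boundedness, on the right-hand side it is the clause \<open>int\<close> of
      \<open>TCF\<close>.\<close>
    have int': "integrable M (\<lambda>w. f n (time_shift (- i) (trajectory w)))"
      by (rule M.integrable_const_bound[of _ 1]) (auto simp: f_nonneg f_le_1)
    have "(\<integral>\<^sup>+\<theta>. ennreal (f n (time_shift (- i) \<theta>)) * 1 \<partial>law) =
        (\<integral>\<^sup>+w. ennreal (f n (time_shift (- i) (trajectory w))) \<partial>M)"
      by (simp add: nn_integral_distr)
    also have "\<dots> = ennreal (\<integral>w. f n (time_shift (- i) (trajectory w)) \<partial>M)"
      by (rule nn_integral_eq_integral[OF int']) (simp add: f_nonneg)
    also have "\<dots> = ennreal (\<integral>w. f n (rescale N i (trajectory w)) * N (\<Theta> i w) powr \<alpha> \<partial>M)"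
      using eq unfolding ind shift by simp
    also have "\<dots> = (\<integral>\<^sup>+w. ennreal (f n (rescale N i (trajectory w)) * N (\<Theta> i w) powr \<alpha>) \<partial>M)"
      using int unfolding ind by (intro nn_integral_eq_integral[symmetric]) (auto simp: f_nonneg)
    also have "\<dots> = (\<integral>\<^sup>+\<theta>. ennreal (f n (rescale N i \<theta>)) * ennreal (N (\<theta> i) powr \<alpha>) \<partial>law)"
      by (simp add: nn_integral_distr ennreal_mult f_nonneg)
    finally show ?thesis .
  qed
  have "(\<lambda>n. \<integral>\<^sup>+\<theta>. ennreal (f n (time_shift (- i) \<theta>)) * 1 \<partial>law)
      \<longlonglongrightarrow> (\<integral>\<^sup>+\<theta>. indicator (PiE UNIV V) (time_shift (- i) \<theta>) \<partial>law)"
    by (rule nn_integral_LIMSEQ) (use lim incseq[of "time_shift (- i)" "\<lambda>_. 1"] in auto)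
  moreover have "(\<lambda>n. \<integral>\<^sup>+\<theta>. ennreal (f n (rescale N i \<theta>)) * ennreal (N (\<theta> i) powr \<alpha>) \<partial>law)
      \<longlonglongrightarrow> (\<integral>\<^sup>+\<theta>. indicator (PiE UNIV V) (rescale N i \<theta>) * ennreal (N (\<theta> i) powr \<alpha>) \<partial>law)"
    by (rule nn_integral_LIMSEQ) (auto intro!: incseq lim_mult)
  ultimately show "(\<integral>\<^sup>+\<theta>. indicator (PiE UNIV V) (time_shift (- i) \<theta>) \<partial>law) =
      (\<integral>\<^sup>+\<theta>. indicator (PiE UNIV V) (rescale N i \<theta>) * ennreal (N (\<theta> i) powr \<alpha>) \<partial>law)"
    unfolding step using LIMSEQ_unique by blast
qed

lemma time_change_imp_TCF:
  assumes "time_change N \<alpha> law"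
  shows "TCF N \<alpha> M \<Theta>"
  unfolding TCF_def
proof (intro conjI allI impI; (elim conjE)?)
  have "AE w in M. N (\<Theta> 0 w) = 1"
    using assms unfolding time_change_def by (subst (asm) AE_distr_iff) auto
  then show "\<P>(w in M. N (\<Theta> 0 w) = 1) = 1"
    by (simp add: M.prob_Collect_eq_1)
next
  fix s t i :: int and f :: "(int \<Rightarrow> real ^ 'd) \<Rightarrow> real"
  assume st: "s \<le> 0" "0 \<le> t"
    and "continuous_map (product_topology (\<lambda>_. euclidean) {s..t}) euclideanreal f"
    and "bounded (f ` PiE {s..t} (\<lambda>_. UNIV))"
    and f0: "\<forall>\<theta>\<in>PiE {s..t} (\<lambda>_. UNIV). \<theta> 0 = 0 \<longrightarrow> f \<theta> = 0"
  define g where "g \<theta> = f (restrict \<theta> {s..t})" for \<theta>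
  have [measurable]: "g \<in> borel_measurable borel"
    unfolding g_def by (rule borel_measurable_restrict) fact
  obtain b where b: "\<bar>g \<theta>\<bar> \<le> b" for \<theta>
    using \<open>bounded _\<close> unfolding bounded_iff g_def by fastforce
  have g0: "g \<theta> = 0" if "\<theta> 0 = 0" for \<theta>
    using f0 that st unfolding g_def by auto
  define A where "A w = g (time_shift (- i) (trajectory w))" for w
  define B where "B w = g (rescale N i (trajectory w)) * N (\<Theta> i w) powr \<alpha>" for w
  \<comment> \<open>Since \<open>ennreal\<close> sends negative reals to 0, \<open>c = 1\<close> and
    \<open>c = - 1\<close> give the positive and negative parts, which decide integrability and the
    value of the integral.\<close>
  have tc: "(\<integral>\<^sup>+w. ennreal (c * A w) \<partial>M) = (\<integral>\<^sup>+w. ennreal (c * B w) \<partial>M)" for c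
  proof -
    define h where "h \<theta> = ennreal (c * g \<theta>)" for \<theta>
    have [measurable]: "h \<in> borel_measurable borel"
      unfolding h_def by measurable
    have "(\<integral>\<^sup>+\<theta>. h (time_shift (- i) \<theta>) \<partial>law) =
        (\<integral>\<^sup>+\<theta>. h (rescale N i \<theta>) * ennreal (N (\<theta> i) powr \<alpha>) \<partial>law)"
    proof -
      have "\<forall>\<theta>. \<theta> 0 = 0 \<longrightarrow> h \<theta> = 0"
        by (simp add: h_def g0)
      then show ?thesis
        using assms \<open>h \<in> _\<close> unfolding time_change_def by blast
    qed
    then show ?thesis
      by (simp add: nn_integral_distr h_def A_def B_def ennreal_mult'' flip: mult.assoc)
  qed
  have [measurable]: "A \<in> borel_measurable M" "B \<in> borel_measurable M"
    unfolding A_def B_def by measurable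
  have int_A: "integrable M A"
    by (rule M.integrable_const_bound[of _ b]) (auto simp: A_def b)
  then have int_B: "integrable M B"
    using tc[of 1] tc[of "- 1"] by (simp add: real_integrable_def)
  have eq: "integral\<^sup>L M A = integral\<^sup>L M B"
    using tc[of 1] tc[of "- 1"] by (simp add: real_lebesgue_integral_def int_A int_B)
  have A: "f (\<lambda>j\<in>{s..t}. \<Theta> (j - i) w) = A w" for w
    by (simp add: A_def g_def time_shift_def)
  have B: "f (\<lambda>j\<in>{s..t}. \<Theta> j w /\<^sub>R N (\<Theta> i w)) * indicator {w. 0 < N (\<Theta> i w)} w *
      N (\<Theta> i w) powr \<alpha> = B w" for w
    by (cases "\<Theta> i w = 0") (simp_all add: B_def g_def rescale_def)
  show "integrable M (\<lambda>w. f (\<lambda>j\<in>{s..t}. \<Theta> j w /\<^sub>R N (\<Theta> i w)) *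
      indicator {w. 0 < N (\<Theta> i w)} w * N (\<Theta> i w) powr \<alpha>)"
    unfolding B by (rule int_B)
  show "(\<integral>w. f (\<lambda>j\<in>{s..t}. \<Theta> (j - i) w) \<partial>M) =
      (\<integral>w. f (\<lambda>j\<in>{s..t}. \<Theta> j w /\<^sub>R N (\<Theta> i w)) *
      indicator {w. 0 < N (\<Theta> i w)} w * N (\<Theta> i w) powr \<alpha> \<partial>M)"
    unfolding A B by (rule eq)
qed

section \<open>The law of the randomly shifted series\<close>

lemma nn_integral_cond_pmf:
  assumes K: "has_cond_pmf M \<Theta> K
      (\<lambda>k w. N (\<Theta> k w) powr \<alpha> / (\<Sum>\<^sub>\<infinity>t. N (\<Theta> t w) powr \<alpha>))"
    and [measurable]: "h \<in> borel_measurable borel"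
  shows "(\<integral>\<^sup>+w. indicator {k} (K w) * h (trajectory w) \<partial>M) =
      (\<integral>\<^sup>+\<theta>. weight N \<alpha> k \<theta> * h \<theta> \<partial>law)"
proof -
  have [measurable]: "K \<in> measurable M (count_space UNIV)"
    and cond: "AE w in M. real_cond_exp M (sigma_of M \<Theta>) (indicator {w \<in> space M. K w = k}) w =
      N (\<Theta> k w) powr \<alpha> / (\<Sum>\<^sub>\<infinity>t. N (\<Theta> t w) powr \<alpha>)"
    using K by (auto simp: has_cond_pmf_def)
  \<comment> \<open>A real-valued version of the weight, to be compared with
    \<open>real_cond_exp\<close>.\<close>
  define p where "p w = enn2real (weight N \<alpha> k (trajectory w))" for w
  have [measurable]: "p \<in> borel_measurable M"
    unfolding p_def by measurable
  have ennreal_p: "AE w in M. ennreal (p w) = weight N \<alpha> k (trajectory w)"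
    using total_mass_trajectory by eventually_elim (auto simp: p_def weight_def divide_ennreal)
  have cond_p: "AE w in M. real_cond_exp M (sigma_of M \<Theta>) (indicator {w \<in> space M. K w = k}) w = p w"
    using total_mass_trajectory cond
    by eventually_elim (auto simp: p_def weight_def divide_ennreal)
  have subalg: "subalgebra M (sigma_of M \<Theta>)"
    unfolding subalgebra_def sigma_of_def
    by (auto simp: sets_vimage_algebra intro!: sets.sigma_sets_subset)
  interpret F: finite_measure_subalgebra M "sigma_of M \<Theta>"
    by unfold_locales (rule subalg)
  have [measurable]: "{w \<in> space M. K w = k} \<in> sets M"
    by measurable
  have int_K: "integrable M (indicator {w \<in> space M. K w = k} :: 'a \<Rightarrow> real)"
    by (simp add: M.emeasure_finite less_top[symmetric])
  have int_p: "integrable M p"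
    by (rule integrable_cong_AE_imp[OF F.real_cond_exp_int(1)[OF int_K] _ cond_p]) measurable
  \<comment> \<open>Preimages of Borel sets under the trajectory lie in
    \<open>sigma_of M \<Theta>\<close>, so the defining property of conditional expectation gives
    equality set by set; integrals of \<open>h\<close> follow.\<close>
  have "distr (density M (indicator {w \<in> space M. K w = k})) borel trajectory =
      density law (weight N \<alpha> k)"
  proof (rule measure_eqI)
    fix A assume "A \<in> sets (distr (density M (indicator {w \<in> space M. K w = k})) borel trajectory)"
    then have A [measurable]: "A \<in> sets borel"
      by simp
    define C where "C = trajectory -` A \<inter> space M"
    have [measurable]: "C \<in> sets M"
      unfolding C_def by measurable
    have C: "C \<in> sets (sigma_of M \<Theta>)"
      unfolding C_def sigma_of_def using A by (rule in_vimage_algebra)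
    have "emeasure (distr (density M (indicator {w \<in> space M. K w = k})) borel trajectory) A =
        (\<integral>\<^sup>+w. ennreal (indicator C w * indicator {w \<in> space M. K w = k} w) \<partial>M)"
      by (simp add: emeasure_distr emeasure_density C_def[symmetric] ennreal_mult ennreal_indicator mult.commute)
    also have "\<dots> = ennreal (\<integral>w\<in>C. indicator {w \<in> space M. K w = k} w \<partial>M)"
      unfolding set_lebesgue_integral_def real_scaleR_def
      using integrable_mult_indicator[OF _ int_K, of C]
      by (intro nn_integral_eq_integral) auto
    also have "\<dots> = ennreal (\<integral>w\<in>C. real_cond_exp M (sigma_of M \<Theta>) (indicator {w \<in> space M. K w = k}) w \<partial>M)"
      by (simp only: F.real_cond_exp_intA[OF int_K C])
    also have "\<dots> = ennreal (\<integral>w. indicator C w * p w \<partial>M)"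
      unfolding set_lebesgue_integral_def real_scaleR_def using cond_p
      by (intro arg_cong[where f = ennreal] integral_cong_AE) (auto elim!: eventually_mono)
    also have "\<dots> = (\<integral>\<^sup>+w. ennreal (indicator C w * p w) \<partial>M)"
      using integrable_mult_indicator[OF _ int_p, of C]
      by (intro nn_integral_eq_integral[symmetric]) (auto simp: p_def)
    also have "\<dots> = (\<integral>\<^sup>+w. weight N \<alpha> k (trajectory w) * indicator A (trajectory w) \<partial>M)"
      using ennreal_p by (intro nn_integral_cong_AE)
        (auto elim!: eventually_mono simp: C_def indicator_def)
    also have "\<dots> = emeasure (density law (weight N \<alpha> k)) A"
      by (simp add: emeasure_density nn_integral_distr)
    finally show "emeasure (distr (density M (indicator {w \<in> space M. K w = k})) borel trajectory) A =
        emeasure (density law (weight N \<alpha> k)) A" .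
  qed simp
  then have "(\<integral>\<^sup>+\<theta>. h \<theta> \<partial>distr (density M (indicator {w \<in> space M. K w = k})) borel trajectory) =
      (\<integral>\<^sup>+\<theta>. weight N \<alpha> k \<theta> * h \<theta> \<partial>law)"
    by (simp add: nn_integral_density)
  moreover have "(\<integral>\<^sup>+\<theta>. h \<theta> \<partial>distr (density M (indicator {w \<in> space M. K w = k})) borel trajectory) =
      (\<integral>\<^sup>+w. indicator {k} (K w) * h (trajectory w) \<partial>M)"
    by (subst nn_integral_distr) (auto simp: nn_integral_density indicator_def intro!: nn_integral_cong)
  ultimately show ?thesis
    by simp
qed

text \<open>Splitting by the value of \<open>K\<close> expands the integral of \<open>h\<close>
  under the law of the shifted series into the sum in \<open>rs_invariant\<close>; indicators then
  recover the law.\<close>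

lemma law_eq_iff_rs_invariant:
  assumes K: "has_cond_pmf M \<Theta> K
      (\<lambda>k w. N (\<Theta> k w) powr \<alpha> / (\<Sum>\<^sub>\<infinity>t. N (\<Theta> t w) powr \<alpha>))"
  shows "distr M borel (\<lambda>w t. \<Theta> (t + K w) w /\<^sub>R N (\<Theta> (K w) w)) = law \<longleftrightarrow> rs_invariant N \<alpha> law"
proof -
  define Y where "Y w = time_shift (K w) (rescale N (K w) (trajectory w))" for w
  have Y: "(\<lambda>w t. \<Theta> (t + K w) w /\<^sub>R N (\<Theta> (K w) w)) = Y"
    by (simp add: Y_def time_shift_def rescale_def fun_eq_iff)
  have [measurable]: "K \<in> measurable M (count_space UNIV)"
    using K by (simp add: has_cond_pmf_def)
  have Y_meas [measurable]: "Y \<in> borel_measurable M"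
    \<comment> \<open>\<open>K\<close> has countably many values, and for each fixed value the map
      is measurable.\<close>
    unfolding Y_def by (rule measurable_compose_countable[where g = K]) measurable
  have nn_Y: "(\<integral>\<^sup>+\<theta>. h \<theta> \<partial>distr M borel Y) =
      (\<integral>\<^sup>+k. \<integral>\<^sup>+\<theta>. weight N \<alpha> k \<theta> * h (time_shift k (rescale N k \<theta>)) \<partial>law \<partial>count_space UNIV)"
    if [measurable]: "h \<in> borel_measurable borel" for h
  proof -
    \<comment> \<open>Only the summand with \<open>k = K w\<close> can contribute.\<close>
    have "h (Y w) = (\<integral>\<^sup>+k. indicator {k} (K w) * h (time_shift k (rescale N k (trajectory w))) \<partial>count_space UNIV)" for w
    proof -
      have "(\<integral>\<^sup>+k. indicator {k} (K w) * h (time_shift k (rescale N k (trajectory w))) \<partial>count_space UNIV) =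
          (\<integral>\<^sup>+k. h (time_shift k (rescale N k (trajectory w))) * indicator {K w} k \<partial>count_space UNIV)"
        by (intro nn_integral_cong) (simp add: indicator_def)
      then show ?thesis
        by (simp add: Y_def)
    qed
    then have "(\<integral>\<^sup>+\<theta>. h \<theta> \<partial>distr M borel Y) =
        (\<integral>\<^sup>+w. \<integral>\<^sup>+k. indicator {k} (K w) * h (time_shift k (rescale N k (trajectory w))) \<partial>count_space UNIV \<partial>M)"
      by (simp add: nn_integral_distr)
    also have "\<dots> = (\<integral>\<^sup>+k. \<integral>\<^sup>+w. indicator {k} (K w) * h (time_shift k (rescale N k (trajectory w))) \<partial>M \<partial>count_space UNIV)"
    proof (rule nn_integral_count_space_nn_integral)
      fix k
      have [measurable]: "(\<lambda>w. indicator {k} (K w) :: ennreal) \<in> borel_measurable M"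
        by (rule measurable_compose[of K M "count_space UNIV"]) simp_all
      show "(\<lambda>w. indicator {k} (K w) * h (time_shift k (rescale N k (trajectory w)))) \<in> borel_measurable M"
        by measurable
    qed simp
    also have "\<dots> = (\<integral>\<^sup>+k. \<integral>\<^sup>+\<theta>. weight N \<alpha> k \<theta> * h (time_shift k (rescale N k \<theta>)) \<partial>law \<partial>count_space UNIV)"
    proof (rule nn_integral_cong)
      fix k
      have "(\<lambda>\<theta>. h (time_shift k (rescale N k \<theta>))) \<in> borel_measurable borel"
        by measurable
      from nn_integral_cond_pmf[OF K this, of k]
      show "(\<integral>\<^sup>+w. indicator {k} (K w) * h (time_shift k (rescale N k (trajectory w))) \<partial>M) =
          (\<integral>\<^sup>+\<theta>. weight N \<alpha> k \<theta> * h (time_shift k (rescale N k \<theta>)) \<partial>law)" .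
    qed
    finally show ?thesis .
  qed
  show ?thesis
    unfolding Y
  proof
    assume eq: "distr M borel Y = law"
    show "rs_invariant N \<alpha> law"
      unfolding rs_invariant_def by (intro ballI nn_Y[unfolded eq, symmetric])
  next
    assume *: "rs_invariant N \<alpha> law"
    show "distr M borel Y = law"
    proof (rule measure_eqI)
      fix A assume "A \<in> sets (distr M borel Y)"
      then have [measurable]: "A \<in> sets borel"
        by simp
      have ind: "indicator A \<in> borel_measurable (borel :: (int \<Rightarrow> real ^ 'd) measure)"
        by measurable
      have "(\<integral>\<^sup>+\<theta>. indicator A \<theta> \<partial>distr M borel Y) = (\<integral>\<^sup>+\<theta>. indicator A \<theta> \<partial>law)"
        by (rule trans[OF nn_Y[OF ind] bspec[OF *[unfolded rs_invariant_def] ind]])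
      then show "emeasure (distr M borel Y) A = emeasure law A"
        by simp
    qed simp
  qed
qed

end

theorem theorem2p3:
  fixes N :: "real ^ 'd \<Rightarrow> real" and \<alpha> :: real
    and M :: "'a measure" and \<Theta> :: "int \<Rightarrow> 'a \<Rightarrow> real ^ 'd" and K :: "'a \<Rightarrow> int"
    and M' :: "'b measure" and \<Theta>RS :: "int \<Rightarrow> 'b \<Rightarrow> real ^ 'd"
  assumes "is_norm N" and "\<alpha> > 0"
    and "time_series M \<Theta>"
    and "AE w in M. (\<lambda>t. N (\<Theta> t w) powr \<alpha>) summable_on UNIV \<and>
           0 < (\<Sum>\<^sub>\<infinity>t. N (\<Theta> t w) powr \<alpha>)"
    and "has_cond_pmf M \<Theta> K
           (\<lambda>k w. N (\<Theta> k w) powr \<alpha> / (\<Sum>\<^sub>\<infinity>t. N (\<Theta> t w) powr \<alpha>))"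
    and "time_series M' \<Theta>RS"
    and "eq_in_dist M' \<Theta>RS M (\<lambda>t w. \<Theta> (t + K w) w /\<^sub>R N (\<Theta> (K w) w))"
  shows "eq_in_dist M' \<Theta>RS M \<Theta> \<longleftrightarrow> TCF N \<alpha> M \<Theta>"
proof -
  interpret M: prob_space M
    using assms(3) by (simp add: time_series_def)
  interpret series N \<alpha> M \<Theta>
    using assms by unfold_locales (auto simp: time_series_def)
  \<comment> \<open>By assumption the law of \<open>\<Theta>RS\<close> can be replaced by that of
    the randomly shifted series.\<close>
  have "eq_in_dist M' \<Theta>RS M \<Theta> \<longleftrightarrow> rs_invariant N \<alpha> law"
    using assms(7) law_eq_iff_rs_invariant[OF assms(5)] by (simp add: eq_in_dist_def)
  also have "\<dots> \<longleftrightarrow> TCF N \<alpha> M \<Theta>"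
    using rs_invariant_iff_time_change TCF_imp_time_change time_change_imp_TCF by blast
  finally show ?thesis .
qed

end
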